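(* The minimal class of a quadratic normalisation $(S,N)$ is either of the form $(c,c')$ with $c,c'$ natural numbers satisfying $|c'-c|\le1$, or is $(\infty,\infty)$. If $S$ is finite, the value $(\infty,\infty)$ is excluded.
   Context: For a set $S$, $S^*$ is the free monoid of words over $S$, $\|w\|$ is word length, $u|v$ is concatenation, $S^{[p]}$ is the set of words of length $p$. A normalisation is a pair $(S,N)$ with $N:S^*\to S^*$ such that for all words $u,v,w$: $\|N(w)\|=\|w\|$; $\|w\|=1$ implies $N(w)=w$; $N(u|N(w)|v)=N(u|w|v)$. A word is $N$-normal if $N(w)=w$. $\overline{N}$ is the restriction of $N$ to $S^{[2]}$; $\overline{N}_i$ applies $\overline{N}$ to the entries in positions $i,i+1$; $\overline{N}_{i_1\cdots i_n}=\overline{N}_{i_n}\circ\cdots\circ\overline{N}_{i_1}$ ($i_1$ first). $(S,N)$ is quadratic if (a) a word is $N$-normal iff each of its length-two factors is, and (b) for every word $w$ there is a finite sequence $u$ of positions with $N(w)=\overline{N}_u(w)$. Write $121\ldots[c]$ and $212\ldots[c]$ for the alternating sequences of $1$'s and $2$'s of length $c$ beginning with $1$ and $2$, respectively. For a natural number $c$, a quadratic normalisation is of left-class $c$ if $N(w)=\overline{N}_{121\ldots[c]}(w)$ for every $w\in S^{[3]}$, and of right-class $c$ if $N(w)=\overline{N}_{212\ldots[c]}(w)$ for every $w\in S^{[3]}$. The minimal left-class is the smallest natural number $c$ such that $(S,N)$ is of left-class $c$ if one exists, and $\infty$ otherwise; the minimal right-class is defined symmetrically. The minimal class is the pair (minimal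 left-class, minimal right-class). *)

theory Defs
  imports Main "HOL-Library.FuncSet" "HOL-Library.Sublist" "HOL-Library.Extended_Nat"
begin

text \<open>
  The free monoid over \<open>S\<close> is \<open>lists S\<close>. A normalisation map is a total HOL function of which
  only the values on \<open>lists S\<close> are relevant.
\<close>

definition words_of_length :: "'a set \<Rightarrow> nat \<Rightarrow> 'a list set" where
  "words_of_length S p = {w \<in> lists S. length w = p}"

locale normalisation =
  fixes S :: "'a set" and N :: "'a list \<Rightarrow> 'a list"
  assumes maps_words: "N \<in> lists S \<rightarrow> lists S"
    and length_preserving: "w \<in> lists S \<Longrightarrow> length (N w) = length w"
    and letter_fixed: "w \<in> lists S \<Longrightarrow> length w = 1 \<Longrightarrow> N w = w"
    and absorb: "u \<in> lists S \<Longrightarrow> v \<in> lists S \<Longrightarrow> w \<in> lists S \<Longrightarrow> N (u @ N w @ v) = N (u @ w @ v)"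

definition normal_word :: "('a list \<Rightarrow> 'a list) \<Rightarrow> 'a list \<Rightarrow> bool" where
  "normal_word N w \<longleftrightarrow> N w = w"

text \<open>
  Positions are counted from 1: the entries in positions \<open>i\<close> and \<open>i + 1\<close> are those with list
  indices \<open>i - 1\<close> and \<open>i\<close>. The definition is meant for \<open>1 \<le> i < length w\<close>.
\<close>

definition Nbar_at :: "('a list \<Rightarrow> 'a list) \<Rightarrow> nat \<Rightarrow> 'a list \<Rightarrow> 'a list" where
  "Nbar_at N i w = take (i - 1) w @ N [w ! (i - 1), w ! i] @ drop (i + 1) w"

text \<open>The first position of the sequence is applied first.\<close>

definition Nbar_seq :: "('a list \<Rightarrow> 'a list) \<Rightarrow> nat list \<Rightarrow> 'a list \<Rightarrow> 'a list" where
  "Nbar_seq N u = fold (Nbar_at N) u"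

locale quadratic_normalisation = normalisation +
  assumes normal_iff_factors:
      "w \<in> lists S \<Longrightarrow>
        normal_word N w \<longleftrightarrow> (\<forall>v. sublist v w \<and> length v = 2 \<longrightarrow> normal_word N v)"
    and computed_by_positions:
      "w \<in> lists S \<Longrightarrow> \<exists>u. (\<forall>i \<in> set u. 1 \<le> i \<and> i < length w) \<and> N w = Nbar_seq N u w"

fun alternating :: "nat \<Rightarrow> nat \<Rightarrow> nat \<Rightarrow> nat list" where
  "alternating a b 0 = []"
| "alternating a b (Suc c) = a # alternating b a c"

definition left_class :: "'a set \<Rightarrow> ('a list \<Rightarrow> 'a list) \<Rightarrow> nat \<Rightarrow> bool" where
  "left_class S N c \<longleftrightarrow> (\<forall>w \<in> words_of_length S 3. N w = Nbar_seq N (alternating 1 2 c) w)"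

definition right_class :: "'a set \<Rightarrow> ('a list \<Rightarrow> 'a list) \<Rightarrow> nat \<Rightarrow> bool" where
  "right_class S N c \<longleftrightarrow> (\<forall>w \<in> words_of_length S 3. N w = Nbar_seq N (alternating 2 1 c) w)"

definition minimal_left_class :: "'a set \<Rightarrow> ('a list \<Rightarrow> 'a list) \<Rightarrow> enat" where
  "minimal_left_class S N =
    (if \<exists>c. left_class S N c then enat (LEAST c. left_class S N c) else \<infinity>)"

definition minimal_right_class :: "'a set \<Rightarrow> ('a list \<Rightarrow> 'a list) \<Rightarrow> enat" where
  "minimal_right_class S N =
    (if \<exists>c. right_class S N c then enat (LEAST c. right_class S N c) else \<infinity>)"

definition minimal_class :: "'a set \<Rightarrow> ('a list \<Rightarrow> 'a list) \<Rightarrow> enat \<times> enat" where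
  "minimal_class S N = (minimal_left_class S N, minimal_right_class S N)"

end

theory Submission
  imports Defs
begin

text \<open>
  Since \<open>N\<close> absorbs a preliminary application of \<open>Nbar_at N 2\<close>, left-class \<open>c\<close> implies right-class
  \<open>c + 1\<close>, and symmetrically; this bounds the difference of the two minimal classes. For finite
  \<open>S\<close>, let \<open>w\<close> have length three. Its image \<open>w'\<close> under the first position is fixed by that
  position, so by idempotence every sequence of positions acts on \<open>w'\<close> as an alternating sequence
  starting with the other position. Hence some alternating sequence normalises \<open>w\<close>; longer ones do
  so as well, and a maximum over the finitely many \<open>w\<close> is a class.
\<close>

lemma Nbar_seq_Nil [simp]: "Nbar_seq N [] w = w"
  by (simp add: Nbar_seq_def)

lemma Nbar_seq_Cons [simp]: "Nbar_seq N (i # u) w = Nbar_seq N u (Nbar_at N i w)"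
  by (simp add: Nbar_seq_def)

lemma Nbar_seq_append [simp]: "Nbar_seq N (u @ v) w = Nbar_seq N v (Nbar_seq N u w)"
  by (simp add: Nbar_seq_def)

lemma set_alternating: "set (alternating a b c) \<subseteq> {a, b}"
  by (induction a b c rule: alternating.induct) auto

text \<open>The parity of \<open>c\<close> decides which of \<open>a\<close> and \<open>b\<close>
  comes first in \<open>v\<close>; recording the letters of \<open>v\<close> is enough for stability
  beyond a normal word.\<close>

lemma alternating_add: "\<exists>v. set v \<subseteq> {a, b} \<and> alternating a b (c + d) = alternating a b c @ v"
proof (induction a b c rule: alternating.induct)
  case (1 a b)
  then show ?case using set_alternating[of a b d] by auto
next
  case (2 a b c)
  then show ?case by auto
qed

lemma split_at_position:
  assumes "1 \<le> i" "i < length w"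
  shows "take (i - 1) w @ [w ! (i - 1), w ! i] @ drop (i + 1) w = w"
proof -
  have "w ! (i - 1) # w ! i # drop (i + 1) w = drop (i - 1) w"
    using assms Cons_nth_drop_Suc[of "i - 1" w] Cons_nth_drop_Suc[of i w] by simp
  then show ?thesis by simp
qed

context normalisation
begin

lemma N_in_lists: "w \<in> lists S \<Longrightarrow> N w \<in> lists S"
  using maps_words by blast

lemma N_idem: "w \<in> lists S \<Longrightarrow> N (N w) = N w"
  using absorb[of "[]" "[]" w] by simp

context
  fixes w :: "'a list" and i :: nat
  assumes w: "w \<in> lists S" and i: "1 \<le> i" "i < length w"
begin

lemma factor_in_lists:
  "take (i - 1) w \<in> lists S" "[w ! (i - 1), w ! i] \<in> lists S" "drop (i + 1) w \<in> lists S"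
  using w i by (auto simp: lists_eq_set dest: in_set_takeD in_set_dropD)

lemma Nbar_at_in_lists: "Nbar_at N i w \<in> lists S"
  using N_in_lists[OF factor_in_lists(2)] factor_in_lists by (simp add: Nbar_at_def)

lemma length_N_factor: "length (N [w ! (i - 1), w ! i]) = 2"
  using length_preserving[OF factor_in_lists(2)] by simp

lemma length_Nbar_at: "length (Nbar_at N i w) = length w"
  using length_N_factor i by (simp add: Nbar_at_def)

lemma N_Nbar_at: "N (Nbar_at N i w) = N w"
  using absorb[OF factor_in_lists(1,3,2)] split_at_position[OF i]
  by (simp add: Nbar_at_def)

lemma Nbar_at_idem: "Nbar_at N i (Nbar_at N i w) = Nbar_at N i w"
proof -
  obtain a b where ab: "N [w ! (i - 1), w ! i] = [a, b]"
    using length_N_factor by (auto simp: numeral_2_eq_2 length_Suc_conv)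
  have eq: "Nbar_at N i w = take (i - 1) w @ [a, b] @ drop (i + 1) w"
    unfolding Nbar_at_def ab ..
  have "N [a, b] = [a, b]"
    using N_idem[OF factor_in_lists(2)] ab by simp
  \<comment> \<open>By this length, the second application reads exactly \<open>a\<close> and
    \<open>b\<close>.\<close>
  moreover have "length (take (i - 1) w) = i - 1" using i by simp
  ultimately show ?thesis
    using i unfolding eq by (auto simp: Nbar_at_def nth_append)
qed

end

lemma Nbar_seq_alternating:
  assumes "w \<in> lists S" "1 \<le> i" "i < length w" "1 \<le> j" "j < length w"
    and "set u \<subseteq> {i, j}" "Nbar_at N i w = w"
  shows "\<exists>k. Nbar_seq N u w = Nbar_seq N (alternating j i k) w"
  using assms
proof (induction u arbitrary: w i j)
  case Nil
  then show ?case by (metis alternating.simps(1))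
next
  case (Cons a u)
  show ?case
  proof (cases "a = i")
    case True
    then show ?thesis using Cons.IH[of w i j] Cons.prems by simp
  next
    case False
    then have a: "a = j" using Cons.prems by auto
    let ?w = "Nbar_at N j w"
    have "\<exists>k. Nbar_seq N u ?w = Nbar_seq N (alternating i j k) ?w"
      using Cons.prems
      by (intro Cons.IH) (auto simp: Nbar_at_in_lists length_Nbar_at Nbar_at_idem)
    then obtain k where "Nbar_seq N u ?w = Nbar_seq N (alternating i j k) ?w" ..
    then have "Nbar_seq N (a # u) w = Nbar_seq N (alternating j i (Suc k)) w"
      by (simp add: a)
    then show ?thesis ..
  qed
qed

text \<open>Common form of the left class (positions 1, 2) and the right class (positions 2, 1), so
  that symmetric arguments are given once.\<close>

definition alternating_class :: "nat \<Rightarrow> nat \<Rightarrow> nat \<Rightarrow> bool" where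
  "alternating_class i j c \<longleftrightarrow>
     (\<forall>w \<in> words_of_length S 3. N w = Nbar_seq N (alternating i j c) w)"

lemma alternating_class_Suc_swap:
  assumes "alternating_class i j c" "j \<in> {1, 2}"
  shows "alternating_class j i (Suc c)"
  unfolding alternating_class_def
proof
  fix w assume "w \<in> words_of_length S 3"
  then have w: "w \<in> lists S" "length w = 3" by (auto simp: words_of_length_def)
  then have j: "1 \<le> j" "j < length w" using assms(2) by auto
  \<comment> \<open>The class property is applied to this word, which has the same image under
    \<open>N\<close> as \<open>w\<close>.\<close>
  have "Nbar_at N j w \<in> words_of_length S 3"
    using Nbar_at_in_lists[OF w(1) j] length_Nbar_at[OF w(1) j] w by (simp add: words_of_length_def)
  then show "N w = Nbar_seq N (alternating j i (Suc c)) w"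
    using assms(1) N_Nbar_at[OF w(1) j] by (simp add: alternating_class_def)
qed

end

context quadratic_normalisation
begin

text \<open>The two letters acted on form a factor of length two, which is normal because the whole
  word is.\<close>

lemma Nbar_at_normal:
  assumes "w \<in> lists S" "1 \<le> i" "i < length w" "normal_word N w"
  shows "Nbar_at N i w = w"
proof -
  have "sublist [w ! (i - 1), w ! i] w"
    using split_at_position[OF assms(2,3)] by (metis sublist_appendI)
  then have "N [w ! (i - 1), w ! i] = [w ! (i - 1), w ! i]"
    using normal_iff_factors[OF assms(1)] assms(4) by (simp add: normal_word_def)
  then show ?thesis
    using split_at_position[OF assms(2,3)] by (simp add: Nbar_at_def)
qed

lemma Nbar_seq_normal:
  assumes "w \<in> lists S" "\<forall>i \<in> set u. 1 \<le> i \<and> i < length w" "normal_word N w"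
  shows "Nbar_seq N u w = w"
  using assms by (induction u) (simp_all add: Nbar_at_normal)

lemma alternating_reaches_normal:
  assumes "w \<in> words_of_length S 3" "{i, j} = {1, 2}"
  shows "\<exists>k. N w = Nbar_seq N (alternating i j k) w"
proof -
  have w: "w \<in> lists S" "length w = 3" using assms by (auto simp: words_of_length_def)
  have ij: "1 \<le> i" "i < length w" "1 \<le> j" "j < length w"
    using assms(2) w by (auto simp: doubleton_eq_iff)
  \<comment> \<open>Passing to \<open>?w\<close> keeps the image under \<open>N\<close> and supplies
    the word fixed by \<open>i\<close> that the reduction to alternating sequences needs. The extra
    application accounts for \<open>Suc k\<close> below.\<close>
  let ?w = "Nbar_at N i w"
  have w': "?w \<in> lists S" "length ?w = length w" "Nbar_at N i ?w = ?w" "N ?w = N w"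
    using w ij by (simp_all add: Nbar_at_in_lists length_Nbar_at Nbar_at_idem N_Nbar_at)
  obtain u where u: "\<forall>i \<in> set u. 1 \<le> i \<and> i < length ?w" "N ?w = Nbar_seq N u ?w"
    using computed_by_positions[OF w'(1)] by blast
  have "set u \<subseteq> {i, j}"
  proof
    fix x assume "x \<in> set u"
    then have "x = 1 \<or> x = 2" using u(1) w'(2) w(2) by fastforce
    then show "x \<in> {i, j}" unfolding assms(2) by simp
  qed
  then obtain k where "Nbar_seq N u ?w = Nbar_seq N (alternating j i k) ?w"
    using Nbar_seq_alternating[of ?w i j u] w' ij by auto
  then have "N w = Nbar_seq N (alternating i j (Suc k)) w"
    using u w' by simp
  then show ?thesis ..
qed

text \<open>After \<open>k\<close> steps the word is already normal, so the remaining positions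
  leave it unchanged.\<close>

lemma alternating_stable:
  assumes "w \<in> words_of_length S 3" "{i, j} = {1, 2}" "k \<le> c"
    and "N w = Nbar_seq N (alternating i j k) w"
  shows "N w = Nbar_seq N (alternating i j c) w"
proof -
  have w: "w \<in> lists S" "length w = 3" using assms by (auto simp: words_of_length_def)
  obtain v where v: "set v \<subseteq> {i, j}" "alternating i j c = alternating i j k @ v"
    using alternating_add[of i j k "c - k"] assms(3) by auto
  have "normal_word N (N w)" by (simp add: normal_word_def N_idem w)
  moreover have "\<forall>x \<in> set v. 1 \<le> x \<and> x < length (N w)"
    using v(1) w length_preserving[OF w(1)] unfolding assms(2) by auto
  ultimately have "Nbar_seq N v (N w) = N w"
    by (intro Nbar_seq_normal N_in_lists w)
  then show ?thesis using v(2) assms(4) by simp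
qed

lemma finite_imp_alternating_class:
  assumes "finite S" "{i, j} = {1, 2}"
  shows "\<exists>c. alternating_class i j c"
proof -
  let ?W = "words_of_length S 3"
  have "finite ?W"
    using finite_lists_length_eq[OF assms(1), of 3]
    by (simp add: words_of_length_def lists_eq_set)
  moreover obtain k where k: "\<And>w. w \<in> ?W \<Longrightarrow> N w = Nbar_seq N (alternating i j (k w)) w"
    using alternating_reaches_normal[OF _ assms(2)] by metis
  ultimately have "k w \<le> Max (k ` ?W)" if "w \<in> ?W" for w
    using that by simp
  \<comment> \<open>If \<open>S\<close> is empty, then so is \<open>?W\<close>; the maximum is
    unspecified, but the class condition is vacuous.\<close>
  then have "alternating_class i j (Max (k ` ?W))"
    unfolding alternating_class_def using alternating_stable[OF _ assms(2) _ k] by blast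
  then show ?thesis ..
qed

end

text \<open>The successor of the least element of \<open>P\<close> satisfies \<open>Q\<close>. Used
  in both directions, this gives the two halves of the bound.\<close>

lemma Least_le_Suc_Least:
  fixes P Q :: "nat \<Rightarrow> bool"
  assumes "\<exists>c. P c" "\<And>c. P c \<Longrightarrow> Q (Suc c)"
  shows "(LEAST c. Q c) \<le> Suc (LEAST c. P c)"
  using assms by (metis LeastI_ex Least_le)

theorem lemma3p3p4:
  fixes S :: "'a set" and N :: "'a list \<Rightarrow> 'a list"
  assumes "quadratic_normalisation S N"
  shows "((\<exists>c c'. minimal_class S N = (enat c, enat c') \<and> \<bar>int c' - int c\<bar> \<le> 1)
            \<or> minimal_class S N = (\<infinity>, \<infinity>))
         \<and> (finite S \<longrightarrow> minimal_class S N \<noteq> (\<infinity>, \<infinity>))"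
proof -
  interpret quadratic_normalisation S N by fact
  let ?L = "left_class S N" and ?R = "right_class S N"
  have L: "?L = alternating_class 1 2" and R: "?R = alternating_class 2 1"
    by (simp_all add: fun_eq_iff left_class_def right_class_def alternating_class_def)
  have LR: "?R (Suc c)" if "?L c" for c
    using alternating_class_Suc_swap[of 1 2 c] that by (simp add: L R)
  have RL: "?L (Suc c)" if "?R c" for c
    using alternating_class_Suc_swap[of 2 1 c] that by (simp add: L R)
  show ?thesis
  \<comment> \<open>By \<open>LR\<close> and \<open>RL\<close>, left and right classes exist
    together or not at all, so this split also settles the right class.\<close>
  proof (cases "\<exists>c. ?L c")
    case True
    then have ex: "\<exists>c. ?R c" using LR by blast
    have "\<bar>int (LEAST c. ?R c) - int (LEAST c. ?L c)\<bar> \<le> 1"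
      using Least_le_Suc_Least[of ?L ?R, OF True LR] Least_le_Suc_Least[of ?R ?L, OF ex RL]
      by linarith
    then show ?thesis
      using True ex by (simp add: minimal_class_def minimal_left_class_def minimal_right_class_def)
  next
    case False
    then have "\<nexists>c. ?R c" using RL by blast
    moreover have "\<not> finite S"
      using finite_imp_alternating_class[of 1 2] False by (auto simp: L)
    ultimately show ?thesis
      using False by (simp add: minimal_class_def minimal_left_class_def minimal_right_class_def)
  qed
qed

end
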